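(* Let $F : \{0,1\}^{\mathbb{Z}} \to \{0,1\}^{\mathbb{Z}}$ be the two-neighbor XOR automaton, $F(x)_i = x_i + x_{i+1} \bmod 2$. There exists a shift-invariant, ergodic (with respect to the shift) probability measure $\mu$ of full support on $\{0,1\}^{\mathbb{Z}}$ such that the sequence $(F^n \mu)_{n \in \mathbb{N}}$ weak-* converges to the Dirac measure $\delta_0$ concentrated on the all-$0$ configuration.
   Context: For a word $w \in \{0,1\}^*$, the cylinder $[w]$ is the set of $x \in \{0,1\}^{\mathbb{Z}}$ with $x_0 \cdots x_{|w|-1} = w$. All probability measures are assumed shift-invariant. The image measure is $F\mu([u]) = \mu(F^{-1}([u]))$. A sequence of measures $\nu_n$ weak-* converges to $\nu$ if $\nu_n([u]) \to \nu([u])$ for every word $u$. A measure $\mu$ has full support if $\mu([u]) > 0$ for all words $u$. *)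

theory Defs
  imports "HOL-Probability.Probability" "HOL-Library.Z2"
begin

text \<open>
  Configurations are functions \<^typ>\<open>int \<Rightarrow> bit\<close>, where \<^typ>\<open>bit\<close> is the field of integers
  modulo 2, so that \<open>+\<close> on cells is addition modulo 2. They carry the product of the
  discrete \<open>\<sigma>\<close>-algebras, which is the Borel \<open>\<sigma>\<close>-algebra of the product topology.
\<close>

type_synonym config = "int \<Rightarrow> bit"

definition config_space :: "config measure" where
  "config_space = (\<Pi>\<^sub>M i\<in>UNIV. count_space UNIV)"

definition cylinder :: "bit list \<Rightarrow> config set" where
  "cylinder w = {x. \<forall>k<length w. x (int k) = w ! k}"

definition shift :: "config \<Rightarrow> config" where
  "shift x = (\<lambda>i. x (i + 1))"

definition xor_ca :: "config \<Rightarrow> config" where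
  "xor_ca x = (\<lambda>i. x i + x (i + 1))"

definition config_prob :: "config measure \<Rightarrow> bool" where
  "config_prob \<mu> \<longleftrightarrow> prob_space \<mu> \<and> sets \<mu> = sets config_space"

definition image_measure :: "(config \<Rightarrow> config) \<Rightarrow> config measure \<Rightarrow> config measure" where
  "image_measure f \<mu> = distr \<mu> config_space f"

definition shift_invariant :: "config measure \<Rightarrow> bool" where
  "shift_invariant \<mu> \<longleftrightarrow> image_measure shift \<mu> = \<mu>"

definition ergodic :: "config measure \<Rightarrow> bool" where
  "ergodic \<mu> \<longleftrightarrow>
     (\<forall>A\<in>sets config_space. shift -` A = A \<longrightarrow> measure \<mu> A = 0 \<or> measure \<mu> A = 1)"

definition full_support :: "config measure \<Rightarrow> bool" where
  "full_support \<mu> \<longleftrightarrow> (\<forall>u. measure \<mu> (cylinder u) > 0)"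

text \<open>
  Cylinders are anchored at position 0, so this notion of convergence agrees with weak-*
  convergence for shift-invariant measures, the only ones it is meant for.
\<close>

definition weak_star_converges :: "(nat \<Rightarrow> config measure) \<Rightarrow> config measure \<Rightarrow> bool" where
  "weak_star_converges \<nu> \<nu>' \<longleftrightarrow>
     (\<forall>u. (\<lambda>n. measure (\<nu> n) (cylinder u)) \<longlonglongrightarrow> measure \<nu>' (cylinder u))"

definition dirac_zero :: "config measure" where
  "dirac_zero = return config_space (\<lambda>_. 0)"

text \<open>
  The constant \<^const>\<open>distr\<close> is the image measure only along measurable maps, and
  \<^const>\<open>measure\<close> is meaningful only on measurable sets; both are the case here.
\<close>

lemma space_config_space [simp]: "space config_space = UNIV"
  by (simp add: config_space_def space_PiM)

lemma measurable_coord [measurable]: "(\<lambda>x. x i) \<in> measurable config_space (count_space UNIV)"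
  unfolding config_space_def by (rule measurable_component_singleton) simp

lemma measurable_into_config_space:
  assumes "\<And>i. (\<lambda>x. f x i) \<in> measurable M (count_space UNIV)"
  shows "f \<in> measurable M config_space"
  unfolding config_space_def
  by (rule measurable_PiM_single') (use assms in auto)

lemma measurable_shift [measurable]: "shift \<in> measurable config_space config_space"
  by (rule measurable_into_config_space) (simp add: shift_def)

lemma UNIV_bit: "(UNIV :: bit set) = {0, 1}"
  using bit_not_zero_iff by blast

lemma measurable_xor_ca [measurable]: "xor_ca \<in> measurable config_space config_space"
proof (rule measurable_into_config_space)
  fix i
  have "(\<lambda>x. (\<lambda>a. x i + a) (x (i + 1))) \<in> measurable config_space (count_space UNIV)"
  proof (rule measurable_compose_countable'[where I = UNIV and f = "\<lambda>a x. x i + a"])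
    show "countable (UNIV :: bit set)"
      by (simp add: UNIV_bit)
  qed (auto intro: measurable_compose[OF measurable_coord])
  then show "(\<lambda>x. xor_ca x i) \<in> measurable config_space (count_space UNIV)"
    by (simp add: xor_ca_def)
qed

lemma measurable_xor_ca_funpow [measurable]:
  "(xor_ca ^^ n) \<in> measurable config_space config_space"
  by (induction n) (auto intro: measurable_comp)

lemma cylinder_sets [measurable]: "cylinder w \<in> sets config_space"
proof -
  have "{x \<in> space config_space. \<forall>k\<in>{..<length w}. x (int k) = w ! k} \<in> sets config_space"
    by measurable
  then show ?thesis
    by (simp add: cylinder_def Ball_def)
qed

end

theory Submission
  imports Defs
begin

text \<open>
  On configurations of period \<open>2 ^ k\<close> the automaton is nilpotent, because \<open>F ^ (2 ^ k)\<close> maps \<open>x\<close> to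
  \<open>x\<close> plus its translate by \<open>2 ^ k\<close>. The measure is a limit of uniform measures on finitely many
  periodic words. Apart from one exceptional word, a word of level \<open>m + 1\<close> is the cyclic
  concatenation of long runs of all the words of level \<open>m\<close>, and the run length grows by factors
  of 2 with the type of the word. Every such word therefore has almost the statistics of the whole of
  level \<open>m\<close>, which gives both convergence and ergodicity. A time \<open>n\<close> beyond the period of level \<open>m\<close>
  annihilates the interior of each run; what survives lives near the ends of runs, and the run
  lengths range over so many scales that for most types the runs are either much longer than \<open>n\<close> or so
  short that \<open>n\<close> exceeds the full period of the word. The exceptional words, of vanishing
  frequency, provide full support.
\<close>

subsection \<open>Orbit frequencies of periodic configurations\<close>

definition periodic :: "nat \<Rightarrow> config \<Rightarrow> bool" where
  "periodic p x \<longleftrightarrow> (\<forall>i. x (i + int p) = x i)"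

definition translate :: "int \<Rightarrow> config \<Rightarrow> config" where
  "translate a x = (\<lambda>i. x (a + i))"

definition depends_on :: "int set \<Rightarrow> config set \<Rightarrow> bool" where
  "depends_on J A \<longleftrightarrow> (\<forall>x y. (\<forall>i\<in>J. x i = y i) \<longrightarrow> (x \<in> A \<longleftrightarrow> y \<in> A))"

definition orbit_freq :: "nat \<Rightarrow> config \<Rightarrow> config set \<Rightarrow> real" where
  "orbit_freq p x A = (\<Sum>z<p. indicator A (translate (int z) x)) / real p"

lemma translate_0 [simp]: "translate 0 x = x"
  by (simp add: translate_def)

lemma translate_translate: "translate a (translate b x) = translate (b + a) x"
  by (simp add: translate_def add.assoc)

lemma periodic_mult:
  assumes "periodic p x" shows "periodic (d * p) x"
proof -
  have "x (i + int (d * p)) = x i" for i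
  proof (induction d)
    case (Suc d)
    have "x (i + int (Suc d * p)) = x ((i + int (d * p)) + int p)"
      by (simp add: algebra_simps)
    then show ?case using Suc assms by (simp add: periodic_def)
  qed simp
  then show ?thesis by (simp add: periodic_def)
qed

lemma periodic_dvd: "periodic p x \<Longrightarrow> p dvd q \<Longrightarrow> periodic q x"
  by (metis dvd_def mult.commute periodic_mult)

lemma translate_period: "periodic p x \<Longrightarrow> translate (a + int p) x = translate a x"
  by (simp add: periodic_def translate_def) (metis add.assoc add.commute)

lemma sum_periodic_shift:
  fixes g :: "nat \<Rightarrow> real"
  assumes "\<And>z. g (z + p) = g z"
  shows "(\<Sum>z<p. g (z + w)) = (\<Sum>z<p. g z)"
proof (induction w)
  case (Suc w)
  have "(\<Sum>z<p. g (z + Suc w)) + g w = (\<Sum>z<Suc p. g (z + w))"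
    by (simp add: sum.lessThan_Suc_shift del: sum.lessThan_Suc)
  also have "\<dots> = (\<Sum>z<p. g (z + w)) + g w"
    using assms[of w] by (simp add: add.commute)
  finally show ?case using Suc by simp
qed simp

lemma sum_periodic_mult:
  fixes g :: "nat \<Rightarrow> real"
  assumes "\<And>z. g (z + p) = g z"
  shows "(\<Sum>z<d * p. g z) = real d * (\<Sum>z<p. g z)"
proof -
  have "g (y + b * p) = g y" for b y
  proof (induction b)
    case (Suc b)
    have "g (y + Suc b * p) = g ((y + b * p) + p)" by (simp add: algebra_simps)
    then show ?case using assms Suc by simp
  qed simp
  then have "(\<Sum>z\<in>{b * p..<b * p + p}. g z) = (\<Sum>z<p. g z)" for b
    using sum.shift_bounds_nat_ivl[of g 0 "b * p" p] by (simp add: lessThan_atLeast0 add.commute)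
  then show ?thesis
    using sum.nat_group[of g p d, symmetric] by simp
qed

lemma orbit_freq_cong_dvd:
  assumes "periodic p x" "p dvd q" "q > 0"
  shows "orbit_freq q x A = orbit_freq p x A"
proof -
  obtain d where d: "q = d * p" using assms(2) by (metis dvd_def mult.commute)
  have "(\<Sum>z<d * p. indicator A (translate (int z) x)) = real d * (\<Sum>z<p. indicator A (translate (int z) x) :: real)"
    by (rule sum_periodic_mult) (simp add: translate_period assms)
  then show ?thesis using assms(3) d by (simp add: orbit_freq_def)
qed

text \<open>Over a full period a translation only permutes the start positions cyclically. This is
  the source of the shift invariance of the limit.\<close>

lemma orbit_freq_translate:
  assumes "periodic p x"
  shows "orbit_freq p x (translate (int w) -` A) = orbit_freq p x A"
proof -
  have "(\<Sum>z<p. indicator A (translate (int (z + w)) x)) = (\<Sum>z<p. indicator A (translate (int z) x) :: real)"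
    by (rule sum_periodic_shift[where g = "\<lambda>z. indicator A (translate (int z) x)"])
       (simp add: translate_period assms)
  moreover have "indicator (translate (int w) -` A) (translate (int z) x)
      = (indicator A (translate (int (z + w)) x) :: real)" for z
    by (simp add: indicator_def translate_translate)
  ultimately show ?thesis by (simp add: orbit_freq_def)
qed

lemma orbit_freq_nonneg: "0 \<le> orbit_freq p x A"
  by (auto simp: orbit_freq_def intro!: divide_nonneg_nonneg sum_nonneg)

lemma orbit_freq_le_1: "orbit_freq p x A \<le> 1"
proof -
  have "(\<Sum>z<p. indicator A (translate (int z) x)) \<le> (\<Sum>z<p. 1 :: real)"
    by (intro sum_mono) (simp add: indicator_def)
  then show ?thesis by (simp add: orbit_freq_def divide_le_eq)
qed

lemma orbit_freq_UNIV: "p > 0 \<Longrightarrow> orbit_freq p x UNIV = 1"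
  by (simp add: orbit_freq_def)

lemma orbit_freq_Un:
  "A \<inter> B = {} \<Longrightarrow> orbit_freq p x (A \<union> B) = orbit_freq p x A + orbit_freq p x B"
  unfolding orbit_freq_def add_divide_distrib[symmetric] sum.distrib[symmetric]
  by (intro arg_cong2[where f = "(/)"] sum.cong) (auto simp: indicator_def)

text \<open>Away from the last \<open>w\<close> positions of each run, \<open>x\<close> looks like one of the words \<open>v b\<close>.\<close>

lemma orbit_freq_concat:
  assumes x: "\<And>b y. b < n \<Longrightarrow> y < R \<Longrightarrow> x (int (b * R + y)) = v b (int y)"
    and v: "\<And>b. b < n \<Longrightarrow> periodic p (v b)" "p dvd R"
    and A: "depends_on {0..<int w} A" and pos: "n > 0" "R > 0"
  shows "\<bar>orbit_freq (n * R) x A - (\<Sum>b<n. orbit_freq p (v b) A) / real n\<bar> \<le> real w / real R"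
proof -
  define f where "f b y = (indicator A (translate (int (b * R + y)) x) :: real)" for b y
  define g where "g b y = (indicator A (translate (int y) (v b)) :: real)" for b y
  have eq: "f b y = g b y" if "b < n" "y < R - w" for b y
  proof -
    have "translate (int (b * R + y)) x i = translate (int y) (v b) i" if i: "i \<in> {0..<int w}" for i
    proof -
      obtain k where k: "i = int k" "k < w" using i by (metis atLeastLessThan_iff nonneg_int_cases of_nat_less_iff)
      then have "y + k < R" using \<open>y < R - w\<close> by simp
      from x[OF \<open>b < n\<close> this] show ?thesis by (simp add: translate_def k algebra_simps)
    qed
    then have "translate (int (b * R + y)) x \<in> A \<longleftrightarrow> translate (int y) (v b) \<in> A"
      using A unfolding depends_on_def by blast
    then show ?thesis unfolding f_def g_def indicator_def by presburger
  qed
  \<comment> \<open>A window of width \<open>w\<close> leaves its run only from the last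
    \<open>w\<close> start positions. If \<open>w > R\<close>, the truncated \<open>R - w\<close> is
    0 and all positions are counted.\<close>
  have diff: "\<bar>(\<Sum>y<R. f b y) - (\<Sum>y<R. g b y)\<bar> \<le> real w" if "b < n" for b
  proof -
    have "\<bar>(\<Sum>y<R. f b y) - (\<Sum>y<R. g b y)\<bar> \<le> (\<Sum>y<R. \<bar>f b y - g b y\<bar>)"
      unfolding sum_subtractf[symmetric] by (rule sum_abs)
    also have "\<dots> \<le> (\<Sum>y<R. if y \<in> {R - w..<R} then 1 else 0)"
      using eq[OF that] by (intro sum_mono) (auto simp: f_def g_def indicator_def)
    also have "\<dots> = real (card ({..<R} \<inter> {R - w..<R}))" by (subst sum.inter_restrict[symmetric]) auto
    also have "\<dots> \<le> real (card {R - w..<R})" by (intro of_nat_mono card_mono) auto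
    finally show ?thesis by simp
  qed
  have 1: "orbit_freq (n * R) x A = (\<Sum>b<n. \<Sum>y<R. f b y) / (real n * real R)"
  proof -
    have "(\<Sum>z\<in>{b * R..<b * R + R}. indicator A (translate (int z) x)) = (\<Sum>y<R. f b y)" for b
      using sum.shift_bounds_nat_ivl[of "\<lambda>z. indicator A (translate (int z) x) :: real" 0 "b * R" R]
      by (simp add: f_def lessThan_atLeast0 add.commute)
    then show ?thesis
      using sum.nat_group[of "\<lambda>z. indicator A (translate (int z) x) :: real" R n, symmetric]
      by (simp add: orbit_freq_def)
  qed
  have "orbit_freq p (v b) A = (\<Sum>y<R. g b y) / real R" if "b < n" for b
    using orbit_freq_cong_dvd[OF v(1)[OF that] v(2) \<open>R > 0\<close>, of A] by (simp add: orbit_freq_def g_def)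
  then have 2: "(\<Sum>b<n. orbit_freq p (v b) A) / real n = (\<Sum>b<n. \<Sum>y<R. g b y) / (real n * real R)"
    by (simp add: sum_divide_distrib[symmetric] mult.commute)
  have "\<bar>(\<Sum>b<n. \<Sum>y<R. f b y) - (\<Sum>b<n. \<Sum>y<R. g b y)\<bar> \<le> (\<Sum>b<n. \<bar>(\<Sum>y<R. f b y) - (\<Sum>y<R. g b y)\<bar>)"
    unfolding sum_subtractf[symmetric] by (rule sum_abs)
  also have "\<dots> \<le> (\<Sum>b<n. real w)" by (intro sum_mono diff) simp
  finally have "\<bar>(\<Sum>b<n. \<Sum>y<R. f b y) - (\<Sum>b<n. \<Sum>y<R. g b y)\<bar> \<le> real n * real w" by simp
  then have "\<bar>(\<Sum>b<n. \<Sum>y<R. f b y) - (\<Sum>b<n. \<Sum>y<R. g b y)\<bar> / (real n * real R) \<le> (real n * real w) / (real n * real R)"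
    by (intro divide_right_mono) auto
  then show ?thesis using pos by (simp add: 1 2 abs_divide flip: diff_divide_distrib)
qed

subsection \<open>The hierarchy of words\<close>

text \<open>Level \<open>m\<close> consists of \<open>types m\<close> words of period \<open>per m\<close>; \<open>exps m\<close> holds the exponents of these two
  powers of 2. The number of types grows fast enough for the changes of frequency
  beyond level \<open>m\<close> to sum up to less than \<open>1 / (types m * per m)\<close>.\<close>

fun exps :: "nat \<Rightarrow> nat \<times> nat" where
  "exps 0 = (0, 0)"
| "exps (Suc m) = (let (s, k) = exps m; s' = s + k + m + 3 in (s', k + s + s' + 2 ^ s'))"

definition types :: "nat \<Rightarrow> nat" where "types m = 2 ^ fst (exps m)"
definition per :: "nat \<Rightarrow> nat" where "per m = 2 ^ snd (exps m)"
text \<open>The factor \<open>per m\<close> keeps the runs in phase, \<open>types (Suc m)\<close>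
  makes the effect of run ends small for windows of width comparable to \<open>per m\<close>, and
  \<open>2 ^ j\<close> spreads the run lengths over as many scales as there are types.\<close>

definition run :: "nat \<Rightarrow> nat \<Rightarrow> nat" where "run m j = per m * types (Suc m) * 2 ^ j"

text \<open>The exceptional word of type 0 repeats the binary digits of its level, so every finite pattern
  occurs in one of them.\<close>

fun word :: "nat \<Rightarrow> nat \<Rightarrow> config" where
  "word 0 j z = 0"
| "word (Suc m) j z =
    (if j = 0 then of_bool (bit (Suc m) (nat (z mod int (per (Suc m)))))
     else word m (nat ((z div int (run m j)) mod int (types m))) z)"

definition freq :: "nat \<Rightarrow> config set \<Rightarrow> real" where
  "freq m A = (\<Sum>j<types m. orbit_freq (per m) (word m j) A) / real (types m)"

lemma types_pos [simp]: "types m > 0" and per_pos [simp]: "per m > 0" and run_pos [simp]: "run m j > 0"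
  by (simp_all add: types_def per_def run_def)

lemma types_Suc: "types (Suc m) = types m * per m * 2 ^ (m + 3)"
  by (simp add: types_def per_def Let_def power_add split_def)

lemma per_Suc: "per (Suc m) = per m * types m * types (Suc m) * 2 ^ types (Suc m)"
proof -
  have "snd (exps (Suc m)) = snd (exps m) + fst (exps m) + fst (exps (Suc m)) + 2 ^ fst (exps (Suc m))"
    by (simp add: Let_def split_def)
  then show ?thesis unfolding types_def per_def by (simp only: power_add)
qed

declare exps.simps(2) [simp del]

text \<open>The last factor of \<open>per (Suc m)\<close>, which is
  \<open>2 ^ types (Suc m)\<close>, absorbs \<open>2 ^ j\<close> for every type
  \<open>j\<close>.\<close>

lemma run_types_dvd: "j < types (Suc m) \<Longrightarrow> run m j * types m dvd per (Suc m)"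
  unfolding run_def per_Suc
  by (auto intro!: mult_dvd_mono le_imp_power_dvd simp: ac_simps)

lemma per_dvd_run: "per m dvd run m j"
  by (simp add: run_def mult.assoc)

lemma run_types_power: "\<exists>k. run m j * types m = 2 ^ k"
  unfolding run_def per_def types_def power_add[symmetric] by blast

text \<open>One cycle visits \<open>types m\<close> runs, after which the run index repeats.
  Periodicity of the lower level is a hypothesis here because the lemma serves as the induction step
  for \<open>periodic_word\<close>. This period depends on \<open>j\<close> and can be far shorter
  than \<open>per (Suc m)\<close>; it decides when the word is annihilated.\<close>

lemma periodic_word_Suc_if:
  assumes "\<And>j. j < types m \<Longrightarrow> periodic (per m) (word m j)" "0 < j"
  shows "periodic (run m j * types m) (word (Suc m) j)"
proof -
  have idx: "(i + int (run m j * types m)) div int (run m j) mod int (types m) = i div int (run m j) mod int (types m)" for i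
  proof -
    have "int (run m j * types m) = int (types m) * int (run m j)" by simp
    then have "(i + int (run m j * types m)) div int (run m j) = int (types m) + i div int (run m j)"
      by (metis add.commute div_mult_self1 less_irrefl of_nat_0_eq_iff run_pos)
    then show ?thesis by (simp only: mod_add_self1)
  qed
  have lt: "nat (a mod int (types m)) < types m" for a
    by (simp add: nat_less_iff)
  have "word m j' (i + int (run m j * types m)) = word m j' i" if "j' < types m" for j' i
    using periodic_dvd[OF assms(1)[OF that], of "run m j * types m"] per_dvd_run[of m j]
    by (simp add: periodic_def)
  then show ?thesis
    using assms(2) lt by (simp only: periodic_def word.simps idx less_imp_neq[symmetric] if_False) simp
qed

lemma periodic_word: "j < types m \<Longrightarrow> periodic (per m) (word m j)"
proof (induction m arbitrary: j)
  case 0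
  show ?case by (simp add: periodic_def)
next
  case (Suc m)
  show ?case
  proof (cases "j = 0")
    case True
    then show ?thesis by (simp add: periodic_def)
  next
    case False
    then show ?thesis
      using periodic_dvd[OF periodic_word_Suc_if[OF Suc.IH] run_types_dvd[OF Suc.prems]] by blast
  qed
qed

lemma periodic_word_Suc: "0 < j \<Longrightarrow> periodic (run m j * types m) (word (Suc m) j)"
  by (rule periodic_word_Suc_if[OF periodic_word])


text \<open>A cycle contains one run of each word of level \<open>m\<close>, all of equal length, so
  the statistics are the average over that level, up to the windows that cross the end of a
  run.\<close>

lemma word_freq:
  assumes A: "depends_on {0..<int w} A" and j: "0 < j" "j < types (Suc m)"
  shows "\<bar>orbit_freq (per (Suc m)) (word (Suc m) j) A - freq m A\<bar> \<le> real w / real (run m j)"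
proof -
  have "word (Suc m) j (int (b * run m j + y)) = word m b (int y)"
    if b: "b < types m" and y: "y < run m j" for b y
  proof -
    have "nat (int (b * run m j + y) div int (run m j) mod int (types m)) = b"
      using b y by (simp flip: zdiv_int zmod_int)
    \<comment> \<open>Lower levels are read at absolute positions; since \<open>per m\<close>
      divides the run length, every run nevertheless starts in phase 0.\<close>
    moreover have "periodic (b * run m j) (word m b)"
      by (rule periodic_dvd[OF periodic_word[OF b]]) (simp add: per_dvd_run dvd_mult)
    then have "word m b (int y + int (b * run m j)) = word m b (int y)"
      by (simp only: periodic_def)
    ultimately show ?thesis using j by (simp add: add.commute)
  qed
  then have "\<bar>orbit_freq (types m * run m j) (word (Suc m) j) A
      - (\<Sum>b<types m. orbit_freq (per m) (word m b) A) / real (types m)\<bar> \<le> real w / real (run m j)"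
    by (intro orbit_freq_concat periodic_word per_dvd_run A) auto
  moreover have "orbit_freq (types m * run m j) (word (Suc m) j) A = orbit_freq (per (Suc m)) (word (Suc m) j) A"
    using orbit_freq_cong_dvd[OF periodic_word_Suc[OF j(1)] run_types_dvd[OF j(2)] per_pos, of A]
    by (simp add: mult.commute)
  ultimately show ?thesis by (simp add: freq_def)
qed

section \<open>Change of the frequencies from level to level\<close>

lemma freq_nonneg: "0 \<le> freq m A"
  by (auto simp: freq_def intro!: divide_nonneg_nonneg sum_nonneg orbit_freq_nonneg)

lemma freq_le_1: "freq m A \<le> 1"
proof -
  have "(\<Sum>j<types m. orbit_freq (per m) (word m j) A) \<le> (\<Sum>j<types m. 1)"
    by (intro sum_mono orbit_freq_le_1)
  then show ?thesis by (simp add: freq_def divide_le_eq)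
qed

lemma freq_UNIV: "freq m UNIV = 1"
  by (simp add: freq_def orbit_freq_UNIV)

lemma freq_Un: "A \<inter> B = {} \<Longrightarrow> freq m (A \<union> B) = freq m A + freq m B"
  by (simp add: freq_def orbit_freq_Un sum.distrib add_divide_distrib)

lemma freq_translate: "freq m (translate (int w) -` A) = freq m A"
  unfolding freq_def by (intro arg_cong2[where f = "(/)"] sum.cong refl orbit_freq_translate periodic_word) simp

text \<open>Type 0 adds an extra deviation of at most 1, and otherwise each type deviates by at most
  \<open>2 / types (Suc m)\<close>, because a run is at least \<open>per m * types (Suc m)\<close>
  long. The deviations sum to at most 3.\<close>

lemma freq_step:
  assumes A: "depends_on {0..<int w} A" and w: "w \<le> 2 * per m"
  shows "\<bar>freq (Suc m) A - freq m A\<bar> \<le> 3 / real (types (Suc m))"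
proof -
  let ?N = "types (Suc m)" and ?o = "\<lambda>j. orbit_freq (per (Suc m)) (word (Suc m) j) A"
  have le: "\<bar>?o j - freq m A\<bar> \<le> (if j = 0 then 1 else 0) + 2 / real ?N" if "j < ?N" for j
  proof (cases "j = 0")
    case True
    have "\<bar>?o j - freq m A\<bar> \<le> 1"
      using orbit_freq_nonneg orbit_freq_le_1 freq_nonneg freq_le_1 by (smt (verit))
    then show ?thesis using True by (simp add: add_increasing2)
  next
    case False
    have "per m * ?N * 1 \<le> run m j" unfolding run_def by (intro mult_le_mono) auto
    then have "real w / real (run m j) \<le> real (2 * per m) / real (per m * ?N)"
      using w by (intro frac_le) (auto simp del: of_nat_mult)
    also have "\<dots> = 2 / real ?N" by simp
    finally show ?thesis using word_freq[OF A _ that] False by simp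
  qed
  have "freq (Suc m) A - freq m A = (\<Sum>j<?N. ?o j - freq m A) / real ?N"
    by (simp add: freq_def[of "Suc m"] sum_subtractf diff_divide_distrib)
  then have "\<bar>freq (Suc m) A - freq m A\<bar> \<le> (\<Sum>j<?N. \<bar>?o j - freq m A\<bar>) / real ?N"
    by (simp add: abs_divide divide_right_mono)
  also have "\<dots> \<le> (\<Sum>j<?N. (if j = 0 then 1 else 0) + 2 / real ?N) / real ?N"
    by (intro divide_right_mono sum_mono le) auto
  also have "(\<Sum>j<?N. (if j = 0 then 1 else 0) + 2 / real ?N) = 3"
    by (simp add: sum.distrib)
  finally show ?thesis .
qed

text \<open>The value of a geometric series: by \<open>types_Suc\<close>, the steps
  \<open>3 / types (Suc i)\<close> are at most \<open>3 / (types m * per m * 2 ^ (i + 3))\<close>,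
  summed here over all \<open>i\<close> from \<open>m\<close> on.\<close>

definition tail :: "nat \<Rightarrow> real" where
  "tail m = 3 / 4 * (1 / 2) ^ m / real (types m * per m)"

lemma types_per_mono: "m \<le> i \<Longrightarrow> types m * per m \<le> types i * per i"
proof (induction i rule: dec_induct)
  case (step i)
  have "types i * per i * 1 \<le> types i * per i * 2 ^ (i + 3)" by (intro mult_le_mono) auto
  also have "\<dots> = types (Suc i) * 1" by (simp add: types_Suc)
  also have "\<dots> \<le> types (Suc i) * per (Suc i)"
    by (intro mult_le_mono) (auto simp: Suc_le_eq)
  finally show ?case using step.IH by linarith
qed simp

lemma per_mono: "m \<le> i \<Longrightarrow> per m \<le> per i"
proof (induction i rule: dec_induct)
  case (step i)
  have "per i * 1 * 1 * 1 \<le> per (Suc i)"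
    unfolding per_Suc by (intro mult_le_mono) (auto simp: Suc_le_eq)
  then show ?case using step.IH by linarith
qed simp

lemma freq_tail:
  assumes A: "depends_on {0..<int w} A" and w: "w \<le> 2 * per m" and "m \<le> i"
  shows "\<bar>freq i A - freq m A\<bar> \<le> tail m"
proof -
  define Q where "Q = real (types m * per m)"
  have Q: "Q > 0" by (simp add: Q_def)
  from \<open>m \<le> i\<close> have "\<bar>freq i A - freq m A\<bar> \<le> 3 / 4 * ((1 / 2) ^ m - (1 / 2) ^ i) / Q"
  proof (induction i rule: dec_induct)
    case (step i)
    have "w \<le> 2 * per i" using w per_mono[OF step.hyps(1)] by linarith
    then have "\<bar>freq (Suc i) A - freq i A\<bar> \<le> 3 / real (types (Suc i))" by (rule freq_step[OF A])
    also have "\<dots> \<le> 3 / (Q * 2 ^ (i + 3))"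
    proof (intro divide_left_mono mult_pos_pos)
      have "types m * per m * 2 ^ (i + 3) \<le> types (Suc i)"
        unfolding types_Suc by (intro mult_le_mono1 types_per_mono step.hyps)
      then have "real (types m * per m * 2 ^ (i + 3)) \<le> real (types (Suc i))" by (rule of_nat_mono)
      then show "Q * 2 ^ (i + 3) \<le> real (types (Suc i))" by (simp add: Q_def)
    qed (use Q in auto)
    \<comment> \<open>Writing the step as a difference lets the bound telescope along the
      induction.\<close>
    also have "\<dots> = 3 / 4 * ((1 / 2) ^ i - (1 / 2) ^ Suc i) / Q"
      using Q by (simp add: field_simps power_add power_one_over)
    finally have "\<bar>freq (Suc i) A - freq m A\<bar> \<le> 3 / 4 * ((1 / 2) ^ m - (1 / 2) ^ i) / Q + 3 / 4 * ((1 / 2) ^ i - (1 / 2) ^ Suc i) / Q"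
      using step.IH by linarith
    also have "\<dots> = 3 / 4 * ((1 / 2) ^ m - (1 / 2) ^ Suc i) / Q"
      unfolding add_divide_distrib[symmetric] distrib_left[symmetric] by simp
    finally show ?case .
  qed simp
  also have "\<dots> \<le> 3 / 4 * (1 / 2) ^ m / Q"
    using Q by (intro divide_right_mono mult_left_mono) auto
  finally show ?thesis by (simp add: tail_def Q_def)
qed

lemma tail_nonneg: "0 \<le> tail m"
  by (simp add: tail_def)

text \<open>The right-hand side is the weight of a single position in a single word of level
  \<open>m\<close>. A pattern seen once at that level thus survives all later changes, which yields
  full support.\<close>

lemma tail_less: "tail m < 1 / real (types m * per m)"
proof -
  have "(1 / 2 :: real) ^ m \<le> 1" by (simp add: power_le_one)
  then have "3 / 4 * (1 / 2 :: real) ^ m < 1" by linarith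
  then show ?thesis unfolding tail_def by (intro divide_strict_right_mono) auto
qed

lemma tail_tendsto_0: "tail \<longlonglongrightarrow> 0"
proof (rule tendsto_sandwich[OF _ _ tendsto_const])
  show "(\<lambda>m. 3 / 4 * (1 / 2 :: real) ^ m) \<longlonglongrightarrow> 0"
    using tendsto_mult_right_zero[OF LIMSEQ_realpow_zero[of "1/2"]] by auto
  have "tail m \<le> 3 / 4 * (1 / 2) ^ m" for m
  proof -
    have "1 \<le> types m * per m" by (simp add: Suc_le_eq)
    then have "1 \<le> real (types m * per m)" by linarith
    then have "3 / 4 * (1 / 2) ^ m / real (types m * per m) \<le> 3 / 4 * (1 / 2) ^ m / 1"
      by (intro divide_left_mono) auto
    then show ?thesis unfolding tail_def by linarith
  qed
  then show "\<forall>\<^sub>F m in sequentially. tail m \<le> 3 / 4 * (1 / 2) ^ m" by simp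
qed (simp add: tail_nonneg)

lemma less_per: "m < per m"
proof (induction m)
  case (Suc m)
  have "(2::nat) ^ 1 \<le> 2 ^ types (Suc m)" by (intro power_increasing) (auto simp: Suc_le_eq)
  then have "per m * 1 * 1 * 2 \<le> per (Suc m)"
    unfolding per_Suc by (intro mult_le_mono) (auto simp: Suc_le_eq)
  then show ?case using Suc.IH by linarith
qed simp

subsection \<open>The automaton on the hierarchy\<close>

lemma xor_ca_translate: "(xor_ca ^^ n) (translate a x) = translate a ((xor_ca ^^ n) x)"
proof (induction n)
  case (Suc n)
  have "xor_ca (translate a y) = translate a (xor_ca y)" for y
    by (simp only: xor_ca_def translate_def add.assoc)
  then show ?case using Suc by simp
qed simp

lemma bit_add_cancel: "a + b + (b + c) = a + (c :: bit)"
  by (cases a; cases b; cases c) simp_all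

text \<open>As a linear map over the field with two elements, the automaton is the identity plus the
  shift, so this is the Frobenius identity: at each squaring the two middle terms cancel.\<close>

lemma xor_ca_power_2: "(xor_ca ^^ (2 ^ k)) x = (\<lambda>i. x i + x (i + 2 ^ k))"
proof (induction k arbitrary: x)
  case (Suc k)
  have "(xor_ca ^^ (2 ^ Suc k)) x = (xor_ca ^^ (2 ^ k)) ((xor_ca ^^ (2 ^ k)) x)"
    by (simp add: funpow_add mult_2)
  also have "\<dots> = (\<lambda>i. x i + x (i + 2 ^ k) + (x (i + 2 ^ k) + x (i + 2 ^ Suc k)))"
    unfolding Suc by (simp only: add.assoc power_Suc mult_2)
  also have "\<dots> = (\<lambda>i. x i + x (i + 2 ^ Suc k))"
    by (simp only: bit_add_cancel)
  finally show ?case .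
qed (simp add: xor_ca_def fun_eq_iff)

lemma xor_ca_zero: "(xor_ca ^^ n) (\<lambda>i. 0) = (\<lambda>i. 0)"
  by (induction n) (simp_all add: xor_ca_def)

lemma xor_ca_periodic_eq_0:
  assumes "periodic (2 ^ k) x" "2 ^ k \<le> n"
  shows "(xor_ca ^^ n) x = (\<lambda>i. 0)"
proof -
  have "(xor_ca ^^ n) x = (xor_ca ^^ (n - 2 ^ k)) ((xor_ca ^^ (2 ^ k)) x)"
    using assms(2) by (metis comp_apply funpow_add le_add_diff_inverse2)
  also have "(xor_ca ^^ (2 ^ k)) x = (\<lambda>i. 0)"
    using assms(1) by (simp add: xor_ca_power_2 periodic_def)
  finally show ?thesis by (simp add: xor_ca_zero)
qed

lemma xor_ca_cong:
  "(\<And>i. a \<le> i \<Longrightarrow> i \<le> a + int n \<Longrightarrow> x i = y i) \<Longrightarrow> (xor_ca ^^ n) x a = (xor_ca ^^ n) y a"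
proof (induction n arbitrary: a)
  case (Suc n)
  have "(xor_ca ^^ n) x a = (xor_ca ^^ n) y a"
    by (rule Suc.IH, rule Suc.prems) auto
  moreover have "(xor_ca ^^ n) x (a + 1) = (xor_ca ^^ n) y (a + 1)"
    by (rule Suc.IH, rule Suc.prems) auto
  moreover have "xor_ca z a = z a + z (a + 1)" for z
    by (simp only: xor_ca_def)
  ultimately show ?case by (simp only: funpow.simps comp_apply)
qed simp

text \<open>Convergence to the Dirac measure amounts to the measure of these sets tending to 0;
  translations carry the estimate to the other cells.\<close>

definition nonzero_at_0 :: "nat \<Rightarrow> config set" where
  "nonzero_at_0 n = {x. (xor_ca ^^ n) x 0 \<noteq> 0}"

lemma depends_on_nonzero_at_0: "depends_on {0..<int (Suc n)} (nonzero_at_0 n)"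
proof -
  have "(xor_ca ^^ n) x 0 = (xor_ca ^^ n) y 0" if "\<forall>i\<in>{0..<int (Suc n)}. x i = y i" for x y
    by (rule xor_ca_cong) (rule that[rule_format], simp)
  then show ?thesis unfolding depends_on_def nonzero_at_0_def mem_Collect_eq by metis
qed

lemma orbit_freq_nonzero_at_0:
  assumes "periodic (2 ^ k) x" "2 ^ k \<le> n"
  shows "orbit_freq p x (nonzero_at_0 n) = 0"
proof -
  have "translate (int z) x \<notin> nonzero_at_0 n" for z
    unfolding nonzero_at_0_def mem_Collect_eq xor_ca_translate xor_ca_periodic_eq_0[OF assms]
    by (simp add: translate_def)
  then show ?thesis by (simp add: orbit_freq_def)
qed

text \<open>The indices below \<open>a - s\<close>, the at most \<open>s\<close> transitional ones,
  and the geometric range from \<open>a\<close> on contribute at most 0, \<open>s\<close> and 2. The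
  bound is independent of \<open>N\<close>, which will be the huge number of types.\<close>

lemma sum_cutoff_le:
  fixes b :: "nat \<Rightarrow> real"
  assumes "\<And>j. b j \<le> 1" "\<And>j. j + s < a \<Longrightarrow> b j \<le> 0" "\<And>j. a \<le> j \<Longrightarrow> b j \<le> (1 / 2) ^ (j - a)"
  shows "(\<Sum>j<N. b j) \<le> real s + 2"
proof -
  have "(\<Sum>j<N. b j) \<le> (\<Sum>j<N. (if j \<in> {a - s..<a} then 1 else 0) + (if a \<le> j then (1 / 2) ^ (j - a) else 0))"
  proof (intro sum_mono)
    fix j
    consider "j + s < a" | "j \<in> {a - s..<a}" | "a \<le> j" by fastforce
    then show "b j \<le> (if j \<in> {a - s..<a} then 1 else 0) + (if a \<le> j then (1 / 2) ^ (j - a) else 0)"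
    proof cases
      case 1
      then have "b j \<le> 0" "j < a" "j < a - s" by (auto intro: assms(2))
      then show ?thesis by simp
    next
      case 2
      then show ?thesis using assms(1)[of j] by simp
    next
      case 3
      then show ?thesis using assms(3)[of j] by simp
    qed
  qed
  also have "\<dots> = (\<Sum>j<N. if j \<in> {a - s..<a} then 1 else 0) + (\<Sum>j<N. if a \<le> j then (1 / 2) ^ (j - a) else 0)"
    by (rule sum.distrib)
  also have "(\<Sum>j<N. if j \<in> {a - s..<a} then 1 else 0) \<le> real s"
  proof -
    have "(\<Sum>j<N. if j \<in> {a - s..<a} then 1 else 0 :: real) = real (card ({..<N} \<inter> {a - s..<a}))"
      by (subst sum.inter_restrict[symmetric]) auto
    also have "\<dots> \<le> real (card {a - s..<a})" by (intro of_nat_mono card_mono) auto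
    finally show ?thesis by simp
  qed
  \<comment> \<open>For \<open>N\<close> up to \<open>a\<close> the truncated exponent is 0 and both
    sides vanish.\<close>
  also have "(\<Sum>j<N. if a \<le> j then (1 / 2) ^ (j - a) else 0) = 2 - 2 * (1 / 2 :: real) ^ (N - a)"
  proof (induction N)
    case (Suc N)
    show ?case
    proof (cases "a \<le> N")
      case True
      then show ?thesis using Suc by (simp add: Suc_diff_le)
    next
      case False
      then show ?thesis using Suc by simp
    qed
  qed simp
  finally have "(\<Sum>j<N. b j) \<le> real s + (2 - 2 * (1 / 2) ^ (N - a))" by simp
  moreover have "(0::real) \<le> (1 / 2) ^ (N - a)" by simp
  ultimately show ?thesis by linarith
qed

text \<open>Type \<open>j\<close> has dyadic period \<open>run m j * types m\<close>, so \<open>n\<close> steps annihilate it if \<open>n\<close> is at least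
  that; if \<open>n\<close> is small against \<open>run m j\<close>, only the few windows that cross the end of a run matter.
  Between the two lie about \<open>log 2 (types m)\<close> of the many types.\<close>

lemma freq_Suc_nonzero_at_0_le:
  assumes n: "per m \<le> n"
  shows "freq (Suc m) (nonzero_at_0 n) \<le> (1 / 2) ^ m"
proof -
  let ?N = "types (Suc m)" and ?D = "nonzero_at_0 n"
  define s where "s = fst (exps m)"
  \<comment> \<open>The value 0 outside the ordinary types makes the bounds of
    \<open>sum_cutoff_le\<close> hold for all \<open>j\<close>; the exceptional type 0 is charged 1
    separately below.\<close>
  define b where "b j = (if 0 < j \<and> j < ?N then orbit_freq (per (Suc m)) (word (Suc m) j) ?D else 0)" for j
  define R where "R = run m 0"
  have run: "run m j = R * 2 ^ j" for j by (simp add: run_def R_def)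
  have "R > 0" by (simp add: R_def)
  \<comment> \<open>Every word of level \<open>m\<close> has died by time \<open>n\<close>, so
    \<open>word_freq\<close> compares a word of the next level with 0.\<close>
  have 0: "freq m ?D = 0"
    using n by (auto simp: freq_def per_def intro!: sum.neutral orbit_freq_nonzero_at_0 periodic_word[unfolded per_def])
  \<comment> \<open>The first scale at which a run is longer than \<open>n\<close>.\<close>
  define a where "a = (LEAST a. n < R * 2 ^ a)"
  have "n < R * 2 ^ n"
    using \<open>R > 0\<close> by (metis less_exp mult.left_neutral mult_le_mono1 order_less_le_trans Suc_leI One_nat_def)
  then have a: "n < R * 2 ^ a" unfolding a_def by (rule LeastI)
  have "(\<Sum>j<?N. b j) \<le> real s + 2"
  proof (rule sum_cutoff_le[where a = a])
    show "b j \<le> 1" for j by (simp add: b_def orbit_freq_le_1)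
    show "b j \<le> 0" if "j + s < a" for j
    proof -
      \<comment> \<open>Minimality of \<open>a\<close> says that \<open>R * 2 ^ (j + s)\<close> is
        at most \<open>n\<close>. As \<open>types m = 2 ^ s\<close>, this number is the period of
        the word of type \<open>j\<close>.\<close>
      have "\<not> n < R * 2 ^ (j + s)" using not_less_Least[of "j + s"] that unfolding a_def by blast
      then have "run m j * types m \<le> n" by (simp add: run types_def s_def power_add mult.assoc)
      then have "orbit_freq (per (Suc m)) (word (Suc m) j) ?D = 0" if "0 < j"
        using run_types_power[of m j] periodic_word_Suc[OF that, of m] orbit_freq_nonzero_at_0 by metis
      then show ?thesis by (simp add: b_def)
    qed
    show "b j \<le> (1 / 2) ^ (j - a)" if "a \<le> j" for j
    proof (cases "0 < j \<and> j < ?N")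
      case True
      have "b j \<le> real (Suc n) / real (run m j)"
        using word_freq[OF depends_on_nonzero_at_0, of j m n] True 0 by (simp add: b_def)
      also have "\<dots> \<le> real (R * 2 ^ a) / real (R * 2 ^ j)"
        unfolding run using a by (intro divide_right_mono of_nat_mono) auto
      also have "\<dots> = (1 / 2) ^ (j - a)"
        using \<open>R > 0\<close> that by (simp add: power_diff power_one_over field_simps)
      finally show ?thesis .
    qed (auto simp: b_def)
  qed
  moreover have "(\<Sum>j<?N. orbit_freq (per (Suc m)) (word (Suc m) j) ?D) \<le> (\<Sum>j<?N. (if j = 0 then 1 else 0) + b j)"
    using orbit_freq_le_1 by (intro sum_mono) (auto simp: b_def)
  moreover have "(\<Sum>j<?N. (if j = 0 then 1 else 0) + b j) = 1 + (\<Sum>j<?N. b j)"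
    by (simp add: sum.distrib)
  ultimately have "freq (Suc m) ?D \<le> (real s + 3) / real ?N"
    unfolding freq_def by (intro divide_right_mono) auto
  \<comment> \<open>Only \<open>s\<close>, the logarithm of \<open>types m\<close>, enters the
    numerator, so \<open>s < 2 ^ s\<close> suffices; the 8 cancels part of
    \<open>2 ^ (m + 3)\<close>.\<close>
  also have "\<dots> \<le> (8 * real (types m)) / real (types m * 2 ^ (m + 3))"
  proof (intro frac_le)
    have "s < types m" "1 \<le> types m" by (auto simp: types_def s_def Suc_le_eq)
    then show "real s + 3 \<le> 8 * real (types m)" by linarith
    have "types m * 1 * 2 ^ (m + 3) \<le> ?N" unfolding types_Suc by (intro mult_le_mono) (auto simp: Suc_le_eq)
    then show "real (types m * 2 ^ (m + 3)) \<le> real ?N" by (intro of_nat_mono) simp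
  qed auto
  also have "\<dots> = (1 / 2) ^ m" by (simp add: power_add power_one_over field_simps)
  finally show ?thesis .
qed

subsection \<open>The limit measure\<close>

text \<open>These are the clopen sets, a generating algebra on which the frequencies converge.
  Symmetric intervals suit translations in both directions.\<close>

definition windows :: "config set set" where
  "windows = {A. \<exists>w. depends_on {-int w..<int w} A}"

lemma depends_on_mono: "depends_on J A \<Longrightarrow> J \<subseteq> K \<Longrightarrow> depends_on K A"
  unfolding depends_on_def by blast

lemma depends_on_translate:
  "depends_on J A \<Longrightarrow> depends_on ((+) a ` J) (translate a -` A)"
  unfolding depends_on_def translate_def vimage_eq
proof (intro allI impI)
  fix x y :: config
  assume A: "\<forall>x y. (\<forall>i\<in>J. x i = y i) \<longrightarrow> (x \<in> A) = (y \<in> A)" and "\<forall>i\<in>(+) a ` J. x i = y i"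
  then have "\<forall>i\<in>J. x (a + i) = y (a + i)" by simp
  then show "((\<lambda>i. x (a + i)) \<in> A) = ((\<lambda>i. y (a + i)) \<in> A)"
    by (rule A[THEN spec, THEN spec, THEN mp])
qed

lemma depends_on_imp_windows:
  assumes "depends_on J A" "finite J" shows "A \<in> windows"
proof -
  have "J \<subseteq> {- int w..<int w}" if "w = Suc (nat (Max (insert 0 (abs ` J))))" for w
  proof
    fix i assume "i \<in> J"
    then have "\<bar>i\<bar> \<le> Max (insert 0 (abs ` J))" using assms(2) by (intro Max_ge) auto
    then show "i \<in> {- int w..<int w}" unfolding that by auto
  qed
  then show ?thesis using depends_on_mono[OF assms(1)] unfolding windows_def by blast
qed

lemma windows_translate: "A \<in> windows \<Longrightarrow> translate a -` A \<in> windows"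
proof -
  assume "A \<in> windows"
  then obtain w where "depends_on {-int w..<int w} A" unfolding windows_def by blast
  from depends_on_imp_windows[OF depends_on_translate[OF this, of a]] show ?thesis by simp
qed

text \<open>The frequency estimates are stated for windows starting at 0; translation invariance
  carries them over to all of \<open>windows\<close>.\<close>

lemma windows_translate_nonneg:
  assumes "A \<in> windows"
  obtains w where "depends_on {0..<int (2 * w)} (translate (int w) -` A)"
proof -
  obtain w where "depends_on {-int w..<int w} A" using assms by (auto simp: windows_def)
  from depends_on_translate[OF this, of "int w"] show ?thesis
    by (intro that[of w]) (simp only: image_add_atLeastLessThan add.left_inverse mult_2 of_nat_add)
qed

lemma algebra_windows: "algebra UNIV windows"
  unfolding algebra_iff_Un
proof (intro conjI ballI)
  show "{} \<in> windows" by (auto simp: windows_def depends_on_def)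
  show "UNIV - A \<in> windows" if A: "A \<in> windows" for A
  proof -
    obtain w where "depends_on {-int w..<int w} A" using A unfolding windows_def by blast
    then have "depends_on {-int w..<int w} (UNIV - A)" unfolding depends_on_def by simp
    then show ?thesis unfolding windows_def by blast
  qed
  show "A \<union> B \<in> windows" if AB: "A \<in> windows" "B \<in> windows" for A B
  proof -
    obtain v w where vw: "depends_on {-int v..<int v} A" "depends_on {-int w..<int w} B"
      using AB unfolding windows_def by blast
    have "depends_on {-int (max v w)..<int (max v w)} A"
      by (rule depends_on_mono[OF vw(1)]) auto
    moreover have "depends_on {-int (max v w)..<int (max v w)} B"
      by (rule depends_on_mono[OF vw(2)]) auto
    ultimately have "depends_on {-int (max v w)..<int (max v w)} (A \<union> B)"
      unfolding depends_on_def Un_iff by metis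
    then show ?thesis unfolding windows_def by blast
  qed
qed simp

lemma sets_config_space_eq: "sets config_space = sigma_sets UNIV windows"
proof
  have "sets config_space = sigma_sets UNIV {{x. x i \<in> A} | i A. True}"
    unfolding config_space_def by (subst sets_PiM_single) simp
  also have "\<dots> \<subseteq> sigma_sets UNIV windows"
  proof (rule sigma_sets_mono')
    have "depends_on {i} {x. x i \<in> A}" for i A by (simp add: depends_on_def)
    then show "{{x. x i \<in> A} | i A. True} \<subseteq> windows" by (auto intro!: depends_on_imp_windows[of "{_}"])
  qed
  finally show "sets config_space \<subseteq> sigma_sets UNIV windows" .
next
  have "A \<in> sets config_space" if A: "depends_on {-int w..<int w} A" for A w
  proof -
    define J where "J = {-int w..<int w}"
    have "(\<lambda>x. restrict x J) ` A \<subseteq> PiE J (\<lambda>_. UNIV)" by auto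
    then have fin: "finite ((\<lambda>x. restrict x J) ` A)"
      by (rule finite_subset) (auto simp: J_def UNIV_bit intro!: finite_PiE)
    \<comment> \<open>A set depending on the finite set \<open>J\<close> is the union of the
      finitely many patterns on \<open>J\<close> that it allows.\<close>
    have "A = (\<Union>y\<in>(\<lambda>x. restrict x J) ` A. {x \<in> space config_space. \<forall>i\<in>J. x i = y i})"
    proof (intro set_eqI iffI)
      fix x assume "x \<in> (\<Union>y\<in>(\<lambda>x. restrict x J) ` A. {x \<in> space config_space. \<forall>i\<in>J. x i = y i})"
      then obtain y where "y \<in> A" "\<forall>i\<in>J. x i = y i" by force
      then show "x \<in> A" using A unfolding depends_on_def J_def[symmetric] by blast
    qed force
    also have "\<dots> \<in> sets config_space"
    proof (intro sets.finite_UN fin)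
      fix y :: config
      have "finite J" by (simp add: J_def)
      then show "{x \<in> space config_space. \<forall>i\<in>J. x i = y i} \<in> sets config_space"
        by measurable
    qed
    finally show ?thesis .
  qed
  then have "windows \<subseteq> sets config_space" by (auto simp: windows_def)
  then show "sigma_sets UNIV windows \<subseteq> sets config_space"
    using sets.sigma_sets_subset[of windows config_space] by simp
qed

lemma windows_sets: "A \<in> windows \<Longrightarrow> A \<in> sets config_space"
  by (simp add: sets_config_space_eq)

text \<open>Compactness of the product space: window sets are open, hence closed by taking
  complements, and nested nonempty closed sets meet.\<close>

lemma decseq_windows_eventually_empty:
  assumes A: "range A \<subseteq> windows" "decseq A" "(\<Inter>i. A i) = {}"
  shows "\<exists>i. A i = {}"
proof (rule ccontr)
  assume ne: "\<nexists>i. A i = {}"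
  define X where "X = product_topology (\<lambda>_::int. discrete_topology (UNIV :: bit set)) UNIV"
  have "compact_space X"
    unfolding X_def compact_space_product_topology by (simp add: compact_space_discrete_topology UNIV_bit)
  moreover have "openin X B" if B: "B \<in> windows" for B
  proof (subst openin_subopen, intro ballI)
    fix x assume "x \<in> B"
    obtain w where w: "depends_on {-int w..<int w} B" using B by (auto simp: windows_def)
    define U where "U = PiE UNIV (\<lambda>i. if i \<in> {-int w..<int w} then {x i} else UNIV)"
    have "{i. (if i \<in> {-int w..<int w} then {x i} else UNIV) \<noteq> UNIV} \<subseteq> {-int w..<int w}" by auto
    then have "openin X U"
      unfolding X_def U_def by (intro product_topology_basis) (auto intro: finite_subset)
    moreover have "x \<in> U" by (simp add: U_def PiE_iff)
    moreover have "U \<subseteq> B"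
    proof
      fix y assume "y \<in> U"
      then have "\<forall>i\<in>{-int w..<int w}. x i = y i" by (auto simp: U_def PiE_iff split: if_splits)
      then show "y \<in> B" using w \<open>x \<in> B\<close> unfolding depends_on_def by blast
    qed
    ultimately show "\<exists>T. openin X T \<and> x \<in> T \<and> T \<subseteq> B" by blast
  qed
  then have "closedin X (A i)" for i
    using A(1) algebra.compl_sets[OF algebra_windows, of "A i"]
    by (auto simp: closedin_def X_def)
  ultimately have "(\<Inter>i. A i) \<noteq> {}"
    using compact_space_imp_nest[of X A] ne A(2) by blast
  then show False using A(3) by blast
qed

section \<open>Limit frequencies and their extension to a measure\<close>

definition lim_freq :: "config set \<Rightarrow> real" where
  "lim_freq A = lim (\<lambda>m. freq m A)"

text \<open>The sequence is Cauchy: \<open>tail\<close> tends to 0, and since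
  \<open>m < per m\<close>, a window of any width is admissible for \<open>freq_tail\<close> from
  some level on.\<close>

lemma freq_LIMSEQ_nonneg:
  assumes A: "depends_on {0..<int w} A"
  shows "(\<lambda>m. freq m A) \<longlonglongrightarrow> lim_freq A"
proof -
  have "Cauchy (\<lambda>m. freq m A)"
  proof (rule CauchyI')
    fix e :: real assume "e > 0"
    have "\<forall>\<^sub>F m in sequentially. tail m < e / 2"
      using tail_tendsto_0 \<open>e > 0\<close> by (intro order_tendstoD(2)) auto
    then obtain M where M: "\<And>m. M \<le> m \<Longrightarrow> tail m < e / 2"
      by (auto simp: eventually_sequentially)
    define m0 where "m0 = max M w"
    have w: "w \<le> 2 * per m0" using less_per[of m0] by (simp add: m0_def)
    have "dist (freq m A) (freq n A) < e" if "m0 \<le> m" "m < n" for m n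
    proof -
      have "\<bar>freq m A - freq m0 A\<bar> \<le> tail m0" "\<bar>freq n A - freq m0 A\<bar> \<le> tail m0"
        using that by (auto intro!: freq_tail[OF A w])
      moreover have "tail m0 < e / 2" by (rule M) (simp add: m0_def)
      ultimately show ?thesis unfolding dist_real_def by linarith
    qed
    then show "\<exists>M. \<forall>m\<ge>M. \<forall>n>m. dist (freq m A) (freq n A) < e" by blast
  qed
  then show ?thesis unfolding lim_freq_def by (simp add: Cauchy_convergent convergent_LIMSEQ_iff[symmetric])
qed

lemma lim_freq_translate: "lim_freq (translate (int w) -` A) = lim_freq A"
  by (simp add: lim_freq_def freq_translate)

lemma freq_LIMSEQ:
  assumes "A \<in> windows"
  shows "(\<lambda>m. freq m A) \<longlonglongrightarrow> lim_freq A"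
proof -
  obtain w where "depends_on {0..<int (2 * w)} (translate (int w) -` A)"
    using windows_translate_nonneg[OF assms] .
  from freq_LIMSEQ_nonneg[OF this] show ?thesis by (simp add: freq_translate lim_freq_translate)
qed

lemma lim_freq_tail:
  assumes A: "depends_on {0..<int w} A" and w: "w \<le> 2 * per m"
  shows "\<bar>lim_freq A - freq m A\<bar> \<le> tail m"
proof (rule LIMSEQ_le_const2)
  show "(\<lambda>i. \<bar>freq i A - freq m A\<bar>) \<longlonglongrightarrow> \<bar>lim_freq A - freq m A\<bar>"
    by (intro tendsto_intros freq_LIMSEQ_nonneg[OF A])
  show "\<exists>N. \<forall>i\<ge>N. \<bar>freq i A - freq m A\<bar> \<le> tail m"
    using freq_tail[OF A w] by blast
qed

text \<open>Caratheodory extension from the algebra of windows. Additivity passes to the limit, and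
  continuity at the empty set is immediate because decreasing sequences with empty intersection are
  eventually empty.\<close>

lemma exists_limit_measure:
  "\<exists>\<mu>. config_prob \<mu> \<and> (\<forall>A\<in>windows. measure \<mu> A = lim_freq A)"
proof -
  interpret windows: algebra UNIV windows by (rule algebra_windows)
  define f where "f A = ennreal (lim_freq A)" for A
  have nonneg: "0 \<le> lim_freq A" if "A \<in> windows" for A
    using freq_LIMSEQ[OF that] by (rule LIMSEQ_le_const) (blast intro: freq_nonneg)
  have Un: "lim_freq (A \<union> B) = lim_freq A + lim_freq B"
    if "A \<in> windows" "B \<in> windows" "A \<inter> B = {}" for A B
  proof (rule LIMSEQ_unique)
    show "(\<lambda>m. freq m (A \<union> B)) \<longlonglongrightarrow> lim_freq (A \<union> B)"
      using that by (intro freq_LIMSEQ windows.Un)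
    show "(\<lambda>m. freq m (A \<union> B)) \<longlonglongrightarrow> lim_freq A + lim_freq B"
      unfolding freq_Un[OF that(3)] by (intro tendsto_add freq_LIMSEQ that)
  qed
  have empty: "lim_freq {} = 0"
    using Un[OF windows.empty_sets windows.empty_sets] by simp
  have "\<exists>\<nu> :: config set \<Rightarrow> ennreal. (\<forall>s\<in>windows. \<nu> s = f s) \<and> measure_space UNIV (sigma_sets UNIV windows) \<nu>"
  proof (rule windows.caratheodory_empty_continuous)
    show "positive windows f" by (simp add: positive_def f_def empty)
    show "additive windows f"
      unfolding additive_def f_def
    proof (intro ballI impI)
      fix A B assume AB: "A \<in> windows" "B \<in> windows" "A \<inter> B = {}"
      show "ennreal (lim_freq (A \<union> B)) = ennreal (lim_freq A) + ennreal (lim_freq B)"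
        unfolding Un[OF AB] by (rule ennreal_plus) (rule nonneg, fact)+
    qed
    show "f A \<noteq> \<infinity>" for A by (simp add: f_def)
    show "(\<lambda>i. f (A i)) \<longlonglongrightarrow> 0" if A: "range A \<subseteq> windows" "decseq A" "(\<Inter>i. A i) = {}" for A
    proof -
      obtain i where "A i = {}" using decseq_windows_eventually_empty[OF A] by blast
      then have "f (A j) = 0" if "i \<le> j" for j
        using decseqD[OF A(2) that] by (simp add: f_def empty)
      then have "\<forall>\<^sub>F j in sequentially. f (A j) = 0"
        unfolding eventually_sequentially by blast
      then show ?thesis by (rule tendsto_eventually)
    qed
  qed
  then obtain \<nu> where \<nu>: "\<And>A. A \<in> windows \<Longrightarrow> \<nu> A = f A" "measure_space UNIV (sigma_sets UNIV windows) \<nu>"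
    by blast
  define \<mu> where "\<mu> = measure_of UNIV windows \<nu>"
  have sets: "sets \<mu> = sigma_sets UNIV windows" and space: "space \<mu> = UNIV"
    by (simp_all add: \<mu>_def)
  have emeasure: "emeasure \<mu> A = f A" if "A \<in> windows" for A
  proof -
    have "emeasure \<mu> A = \<nu> A"
      by (rule emeasure_measure_of[OF \<mu>_def])
         (use \<nu>(2) that in \<open>simp_all add: measure_space_def sets\<close>)
    then show ?thesis using \<nu>(1)[OF that] by simp
  qed
  have "lim_freq UNIV = 1" by (simp add: lim_freq_def freq_UNIV)
  then have "prob_space \<mu>"
    by (intro prob_spaceI) (simp only: emeasure[OF windows.top] space f_def ennreal_1)
  moreover have "measure \<mu> A = lim_freq A" if "A \<in> windows" for A
    unfolding measure_def emeasure[OF that] f_def using nonneg[OF that] by (rule enn2real_ennreal)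
  ultimately show ?thesis
    using sets sets_config_space_eq unfolding config_prob_def by metis
qed

section \<open>Translations and shift-invariant sets\<close>

lemma shift_eq_translate: "shift = translate 1"
  by (simp add: shift_def translate_def fun_eq_iff add.commute)

lemma translate_Suc_vimage: "translate (int (Suc n)) -` A = shift -` (translate (int n) -` A)"
  by (auto simp: shift_eq_translate translate_translate)

lemma translate_invariant: "shift -` A = A \<Longrightarrow> translate (int n) -` A = A"
proof (induction n)
  case 0
  show ?case by auto
next
  case (Suc n)
  then show ?case by (simp only: translate_Suc_vimage)
qed

lemma measurable_translate [measurable]: "translate a \<in> measurable config_space config_space"
  by (rule measurable_into_config_space) (simp add: translate_def)

lemma translate_sets: "A \<in> sets config_space \<Longrightarrow> translate a -` A \<in> sets config_space"
  using measurable_sets[OF measurable_translate, of A a] by simp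

lemma Int_stable_windows: "Int_stable windows"
proof -
  interpret windows: algebra UNIV windows by (rule algebra_windows)
  show ?thesis by (simp add: Int_stable_def windows.Int)
qed

section \<open>Positive frequency of every cylinder\<close>

lemma depends_on_cylinder: "depends_on {0..<int (length u)} (cylinder u)"
proof -
  have "x \<in> cylinder u \<longleftrightarrow> y \<in> cylinder u" if eq: "\<forall>i\<in>{0..<int (length u)}. x i = y i" for x y
  proof -
    have "x (int k) = y (int k)" if "k < length u" for k
      using bspec[OF eq, of "int k"] that by simp
    then show ?thesis by (simp add: cylinder_def)
  qed
  then show ?thesis unfolding depends_on_def by blast
qed

lemma exists_word_in_cylinder: "\<exists>m. length u \<le> per m \<and> word m 0 \<in> cylinder u"
proof -
  \<comment> \<open>The level is the number whose binary digits, lowest first, are \<open>u\<close>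
    followed by a 1. The extra digit makes the level exceed \<open>length u\<close>, so it is a
    successor and its period has room for \<open>u\<close>.\<close>
  define bs where "bs = map (\<lambda>b. b = 1) u @ [True]"
  define a :: nat where "a = horner_sum of_bool 2 bs"
  have "2 ^ length u \<le> a" by (simp add: a_def bs_def horner_sum_append)
  then have "length u < a" using less_exp[of "length u"] by linarith
  then obtain m where m: "a = Suc m" by (cases a) auto
  have le: "length u < per a" using less_per[of a] \<open>length u < a\<close> by linarith
  have "word a 0 (int k) = u ! k" if k: "k < length u" for k
  proof -
    have "nat (int k mod int (per a)) = k" using k le by (simp flip: zmod_int)
    then have "word a 0 (int k) = of_bool (bit a k)" using m by simp
    also have "bit a k \<longleftrightarrow> u ! k = 1"
      using k by (simp add: a_def bit_horner_sum_bit_iff bs_def nth_append)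
    finally show ?thesis using bit_not_one_iff[of "u ! k"] by (cases "u ! k = 1") simp_all
  qed
  then show ?thesis using le by (intro exI[of _ a]) (simp add: cylinder_def)
qed

text \<open>Only position 0 of the word of type 0 is counted.\<close>

lemma freq_ge:
  assumes "word m 0 \<in> A"
  shows "1 / real (types m * per m) \<le> freq m A"
proof -
  have "1 = (\<Sum>z\<in>{0}. indicator A (translate (int z) (word m 0)) :: real)"
    using assms by simp
  also have "\<dots> \<le> (\<Sum>z<per m. indicator A (translate (int z) (word m 0)))"
    by (intro sum_mono2) auto
  finally have "1 / real (per m) \<le> orbit_freq (per m) (word m 0) A"
    unfolding orbit_freq_def by (intro divide_right_mono) auto
  also have "\<dots> = (\<Sum>j\<in>{0}. orbit_freq (per m) (word m j) A)" by simp
  also have "\<dots> \<le> (\<Sum>j<types m. orbit_freq (per m) (word m j) A)"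
    by (intro sum_mono2) (auto simp: orbit_freq_nonneg)
  finally have "1 / real (per m) / real (types m) \<le> freq m A"
    unfolding freq_def by (intro divide_right_mono) auto
  then show ?thesis by (simp add: mult.commute)
qed

lemma lim_freq_cylinder_pos: "0 < lim_freq (cylinder u)"
proof -
  obtain m where m: "length u \<le> per m" "word m 0 \<in> cylinder u"
    using exists_word_in_cylinder by blast
  have "\<bar>lim_freq (cylinder u) - freq m (cylinder u)\<bar> \<le> tail m"
    by (rule lim_freq_tail[OF depends_on_cylinder]) (use m(1) in simp)
  then show ?thesis using freq_ge[OF m(2)] tail_less[of m] by linarith
qed

text \<open>Choose \<open>m\<close> with \<open>n\<close> between \<open>per m\<close> and
  \<open>per (Suc m)\<close>. The lower bound makes the frequency at level \<open>Suc m\<close>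
  small; the upper bound makes the window of width \<open>Suc n\<close> narrow enough for
  \<open>lim_freq_tail\<close> at that level.\<close>

lemma lim_freq_nonzero_at_0_tendsto_0: "(\<lambda>n. lim_freq (nonzero_at_0 n)) \<longlonglongrightarrow> 0"
proof (rule LIMSEQ_I)
  fix e :: real assume "e > 0"
  have "(\<lambda>m. (1 / 2) ^ m + tail (Suc m)) \<longlonglongrightarrow> 0 + 0"
    by (intro tendsto_add LIMSEQ_realpow_zero LIMSEQ_Suc[OF tail_tendsto_0]) auto
  then have "\<forall>\<^sub>F m in sequentially. (1 / 2) ^ m + tail (Suc m) < e"
    using \<open>e > 0\<close> by (intro order_tendstoD(2)) auto
  then obtain M where M: "\<And>m. M \<le> m \<Longrightarrow> (1 / 2) ^ m + tail (Suc m) < e"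
    unfolding eventually_sequentially by blast
  have "norm (lim_freq (nonzero_at_0 n) - 0) < e" if n: "per M \<le> n" for n
  proof -
    define m' where "m' = (LEAST m. n < per m)"
    have m': "n < per m'" unfolding m'_def by (rule LeastI[of _ n]) (rule less_per)
    then have "M < m'" using n per_mono[of m' M] by (meson leD leI order.strict_trans1)
    then obtain m where m: "m' = Suc m" "M \<le> m" by (cases m') auto
    have "\<not> n < per m" using not_less_Least[of m "\<lambda>m. n < per m"] m(1) unfolding m'_def by simp
    then have "freq (Suc m) (nonzero_at_0 n) \<le> (1 / 2) ^ m"
      by (intro freq_Suc_nonzero_at_0_le) simp
    moreover have "\<bar>lim_freq (nonzero_at_0 n) - freq (Suc m) (nonzero_at_0 n)\<bar> \<le> tail (Suc m)"
      by (rule lim_freq_tail[OF depends_on_nonzero_at_0]) (use m' m(1) in simp)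
    moreover have "0 \<le> lim_freq (nonzero_at_0 n)"
      using freq_LIMSEQ_nonneg[OF depends_on_nonzero_at_0]
      by (rule LIMSEQ_le_const) (blast intro: freq_nonneg)
    ultimately show ?thesis using M[OF m(2)] unfolding real_norm_def by linarith
  qed
  then show "\<exists>no. \<forall>n\<ge>no. norm (lim_freq (nonzero_at_0 n) - 0) < e" by blast
qed

section \<open>Typical stretches, in preparation for ergodicity\<close>

lemma orbit_freq_translate_config:
  "orbit_freq p (translate (int w) x) A = orbit_freq p x (translate (int w) -` A)"
proof -
  have "translate (int z) (translate (int w) x) = translate (int w) (translate (int z) x)" for z
    by (simp add: translate_translate add.commute)
  then show ?thesis by (simp add: orbit_freq_def indicator_def)
qed

text \<open>A stretch of length \<open>per (Suc m)\<close> of a word of level \<open>Suc m\<close> is a full period, so its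
  statistics are exactly those of the word.\<close>

definition atypical :: "nat \<Rightarrow> nat \<Rightarrow> config set \<Rightarrow> config set" where
  "atypical w m B = {x. real w / real (per m) < \<bar>orbit_freq (per (Suc m)) x B - freq m B\<bar>}"

text \<open>Windows of width \<open>w\<close> are read from \<open>per (Suc m)\<close> start
  positions. For \<open>w\<close> up to \<open>per (Suc m)\<close> the total width stays within the
  allowance \<open>2 * per (Suc m)\<close> of \<open>lim_freq_tail\<close>.\<close>

lemma depends_on_atypical:
  assumes B: "depends_on {0..<int w} B"
  shows "depends_on {0..<int (per (Suc m) + w)} (atypical v m B)"
proof -
  have "orbit_freq (per (Suc m)) x B = orbit_freq (per (Suc m)) y B"
    if eq: "\<forall>i\<in>{0..<int (per (Suc m) + w)}. x i = y i" for x y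
  proof -
    have "translate (int z) x \<in> B \<longleftrightarrow> translate (int z) y \<in> B" if z: "z < per (Suc m)" for z
    proof -
      have "\<forall>i\<in>{0..<int w}. translate (int z) x i = translate (int z) y i"
      proof
        fix i assume "i \<in> {0..<int w}"
        then have "int z + i \<in> {0..<int (per (Suc m) + w)}" using z by simp
        from bspec[OF eq this] show "translate (int z) x i = translate (int z) y i"
          by (simp only: translate_def)
      qed
      then show ?thesis using B unfolding depends_on_def by blast
    qed
    then show ?thesis
      unfolding orbit_freq_def
      by (intro arg_cong2[where f = "(/)"] sum.cong refl) (simp add: indicator_def)
  qed
  then show ?thesis unfolding depends_on_def atypical_def mem_Collect_eq by metis
qed

text \<open>An ordinary word is typical in every phase by \<open>word_freq\<close>, so only the
  exceptional type contributes.\<close>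

lemma freq_atypical_le:
  assumes B: "depends_on {0..<int w} B"
  shows "freq (Suc m) (atypical w m B) \<le> (1 / 2) ^ m"
proof -
  let ?p = "per (Suc m)" and ?N = "types (Suc m)"
  have "orbit_freq ?p (word (Suc m) j) (atypical w m B) \<le> (if j = 0 then 1 else 0)" if j: "j < ?N" for j
  proof (cases "j = 0")
    case False
    have "translate (int z) (word (Suc m) j) \<notin> atypical w m B" for z
    proof -
      have "orbit_freq ?p (translate (int z) (word (Suc m) j)) B = orbit_freq ?p (word (Suc m) j) B"
        unfolding orbit_freq_translate_config by (rule orbit_freq_translate[OF periodic_word[OF j]])
      moreover have "\<bar>orbit_freq ?p (word (Suc m) j) B - freq m B\<bar> \<le> real w / real (run m j)"
        using False j by (intro word_freq[OF B]) auto
      moreover have "per m \<le> run m j" by (rule dvd_imp_le[OF per_dvd_run run_pos])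
      then have "real w / real (run m j) \<le> real w / real (per m)"
        by (intro divide_left_mono) auto
      ultimately show ?thesis unfolding atypical_def mem_Collect_eq by linarith
    qed
    then show ?thesis using False by (simp add: orbit_freq_def)
  qed (simp add: orbit_freq_le_1)
  then have "(\<Sum>j<?N. orbit_freq ?p (word (Suc m) j) (atypical w m B)) \<le> (\<Sum>j<?N. if j = 0 then 1 else 0)"
    by (intro sum_mono) simp
  then have "freq (Suc m) (atypical w m B) \<le> 1 / real ?N"
    unfolding freq_def by (intro divide_right_mono) simp_all
  also have "\<dots> \<le> 1 / real (2 ^ m)"
  proof (intro divide_left_mono of_nat_mono)
    have "1 * 1 * 2 ^ m \<le> ?N" unfolding types_Suc by (intro mult_le_mono) (auto simp: Suc_le_eq)
    then show "2 ^ m \<le> ?N" by simp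
  qed auto
  finally show ?thesis by (simp add: power_one_over)
qed

section \<open>Invariance, support, convergence and ergodicity of the limit measure\<close>

locale limit_measure =
  fixes \<mu> :: "config measure"
  assumes config_prob: "config_prob \<mu>"
    and measure_windows: "\<And>A. A \<in> windows \<Longrightarrow> measure \<mu> A = lim_freq A"
begin

sublocale prob_space \<mu>
  using config_prob by (simp add: config_prob_def)

lemma sets_eq [simp, measurable_cong]: "sets \<mu> = sets config_space"
  using config_prob by (simp add: config_prob_def)

lemma space_eq [simp]: "space \<mu> = UNIV"
  using sets_eq_imp_space_eq[OF sets_eq] by simp

lemma measure_image:
  assumes f: "f \<in> measurable config_space config_space" and A: "A \<in> sets config_space"
  shows "measure (image_measure f \<mu>) A = measure \<mu> (f -` A)"
proof -
  have "f \<in> measurable \<mu> config_space" using f by (simp cong: measurable_cong_sets)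
  then show ?thesis unfolding image_measure_def using A by (simp add: measure_distr)
qed

text \<open>Both are probability measures, and they agree on the intersection-stable generator
  \<open>windows\<close>.\<close>

lemma shift_invariant: "shift_invariant \<mu>"
  unfolding shift_invariant_def
proof -
  interpret windows: algebra UNIV windows by (rule algebra_windows)
  interpret image: prob_space "image_measure shift \<mu>"
    unfolding image_measure_def by (rule prob_space_distr) simp
  show "image_measure shift \<mu> = \<mu>"
  proof (rule measure_eqI_generator_eq[OF Int_stable_windows, where \<Omega> = UNIV and A = "\<lambda>_. UNIV"])
    fix A assume A: "A \<in> windows"
    have "measure (image_measure shift \<mu>) A = measure \<mu> (translate (int 1) -` A)"
      using A by (subst measure_image) (simp_all add: windows_sets shift_eq_translate)
    also have "\<dots> = measure \<mu> A"
      using A by (simp only: measure_windows windows_translate lim_freq_translate)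
    finally show "emeasure (image_measure shift \<mu>) A = emeasure \<mu> A"
      by (simp only: image.emeasure_eq_measure emeasure_eq_measure)
  next
    show "emeasure (image_measure shift \<mu>) UNIV \<noteq> \<infinity>"
      by (simp only: image.emeasure_eq_measure ennreal_neq_top infinity_ennreal_def not_False_eq_True)
    show "range (\<lambda>_::nat. UNIV) \<subseteq> windows" using windows.top by blast
  qed (simp_all add: image_measure_def sets_config_space_eq)
qed

lemma measure_translate:
  assumes "A \<in> sets config_space"
  shows "measure \<mu> (translate (int n) -` A) = measure \<mu> A"
proof (induction n)
  case 0
  have "translate (int 0) -` A = A" by auto
  then show ?case by (simp only:)
next
  case (Suc n)
  have "measure \<mu> (shift -` (translate (int n) -` A)) = measure \<mu> (translate (int n) -` A)"
    using shift_invariant measure_image[OF measurable_shift translate_sets[OF assms]]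
    unfolding shift_invariant_def by metis
  then show ?case using Suc by (simp only: translate_Suc_vimage)
qed

lemma full_support: "full_support \<mu>"
  unfolding full_support_def
proof
  fix u
  have "cylinder u \<in> windows" by (rule depends_on_imp_windows[OF depends_on_cylinder]) simp
  then show "0 < measure \<mu> (cylinder u)" using lim_freq_cylinder_pos by (simp only: measure_windows)
qed

text \<open>By invariance, each cell is nonzero after \<open>n\<close> steps with the same
  probability \<open>d n\<close>, which tends to 0.\<close>

lemma weak_star: "weak_star_converges (\<lambda>n. image_measure (xor_ca ^^ n) \<mu>) dirac_zero"
  unfolding weak_star_converges_def
proof
  fix u
  define D where "D n k = translate (int k) -` nonzero_at_0 n" for n k
  define d where "d n = lim_freq (nonzero_at_0 n)" for n
  have nonzero: "nonzero_at_0 n \<in> windows" for n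
    by (rule depends_on_imp_windows[OF depends_on_nonzero_at_0]) simp
  have D_windows: "D n k \<in> windows" for n k
    unfolding D_def by (rule windows_translate[OF nonzero])
  have measure_D: "measure \<mu> (D n k) = d n" for n k
    using measure_windows[OF D_windows[of n k]] unfolding D_def d_def lim_freq_translate .
  have D_sets: "D n k \<in> sets \<mu>" for n k
    unfolding sets_eq by (rule windows_sets[OF D_windows])
  have D_iff: "x \<in> D n k \<longleftrightarrow> (xor_ca ^^ n) x (int k) \<noteq> 0" for x n k
  proof -
    have "(xor_ca ^^ n) (translate (int k) x) 0 = (xor_ca ^^ n) x (int k)"
      by (subst xor_ca_translate) (simp only: translate_def add_0_right)
    then show ?thesis unfolding D_def nonzero_at_0_def vimage_eq mem_Collect_eq by (rule arg_cong)
  qed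
  have d0: "d \<longlonglongrightarrow> 0" unfolding d_def by (rule lim_freq_nonzero_at_0_tendsto_0)
  define P where "P n = (xor_ca ^^ n) -` cylinder u" for n
  have P_iff: "x \<in> P n \<longleftrightarrow> (\<forall>k<length u. (xor_ca ^^ n) x (int k) = u ! k)" for x n
    by (simp only: P_def cylinder_def vimage_eq mem_Collect_eq)
  have P_sets: "P n \<in> sets \<mu>" for n
    unfolding P_def using measurable_sets[OF measurable_xor_ca_funpow cylinder_sets, of n u] by simp
  have image: "measure (image_measure (xor_ca ^^ n) \<mu>) (cylinder u) = measure \<mu> (P n)" for n
    unfolding P_def by (rule measure_image[OF measurable_xor_ca_funpow cylinder_sets])
  have dirac: "measure dirac_zero (cylinder u) = indicator (cylinder u) (\<lambda>_. 0)"
    unfolding dirac_zero_def by (simp add: measure_return)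
  have "(\<lambda>n. measure \<mu> (P n)) \<longlonglongrightarrow> indicator (cylinder u) (\<lambda>_. 0)"
  \<comment> \<open>A nonzero letter of \<open>u\<close> forces a nonzero cell, so the preimage has
    measure at most \<open>d n\<close>. If \<open>u\<close> is all zero, a union bound over its
    cells controls the complement.\<close>
  proof (cases "\<exists>k<length u. u ! k \<noteq> 0")
    case True
    then obtain k where k: "k < length u" "u ! k \<noteq> 0" by blast
    then have "indicator (cylinder u) (\<lambda>_. 0) = (0 :: real)"
      by (auto simp: indicator_def cylinder_def)
    moreover have "measure \<mu> (P n) \<le> d n" for n
    proof -
      have "P n \<subseteq> D n k"
      proof
        fix x assume "x \<in> P n"
        then have "(xor_ca ^^ n) x (int k) = u ! k" using k(1) unfolding P_iff by blast
        then show "x \<in> D n k" unfolding D_iff using k(2) by (simp only: not_False_eq_True)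
      qed
      then show ?thesis using finite_measure_mono[OF _ D_sets] measure_D by metis
    qed
    then have "(\<lambda>n. measure \<mu> (P n)) \<longlonglongrightarrow> 0"
      by (intro tendsto_sandwich[OF _ _ tendsto_const d0]) simp_all
    ultimately show ?thesis by simp
  next
    case False
    then have "indicator (cylinder u) (\<lambda>_. 0) = (1 :: real)"
      by (simp add: indicator_def cylinder_def)
    moreover have lower: "1 - real (length u) * d n \<le> measure \<mu> (P n)" for n
    proof -
      have "UNIV - P n \<subseteq> (\<Union>k<length u. D n k)"
      proof
        fix x assume "x \<in> UNIV - P n"
        then obtain k where "k < length u" "(xor_ca ^^ n) x (int k) \<noteq> u ! k" using P_iff by blast
        then show "x \<in> (\<Union>k<length u. D n k)" using False unfolding UN_iff D_iff by auto
      qed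
      then have "measure \<mu> (UNIV - P n) \<le> measure \<mu> (\<Union>k<length u. D n k)"
        by (rule finite_measure_mono) (intro sets.finite_UN finite_lessThan D_sets)
      also have "\<dots> \<le> (\<Sum>k<length u. measure \<mu> (D n k))"
        by (intro finite_measure_subadditive_finite finite_lessThan image_subsetI D_sets)
      also have "\<dots> = real (length u) * d n" by (simp add: measure_D)
      finally show ?thesis using prob_compl[OF P_sets, of n] by simp
    qed
    moreover have "(\<lambda>n. 1 - real (length u) * d n) \<longlonglongrightarrow> 1 - real (length u) * 0"
      by (rule tendsto_diff[OF tendsto_const tendsto_mult[OF tendsto_const d0]])
    then have lower_lim: "(\<lambda>n. 1 - real (length u) * d n) \<longlonglongrightarrow> 1" by simp
    have "(\<lambda>n. measure \<mu> (P n)) \<longlonglongrightarrow> 1"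
      by (rule tendsto_sandwich[OF _ _ lower_lim tendsto_const])
         (rule always_eventually allI lower prob_le_1)+
    ultimately show ?thesis by simp
  qed
  then show "(\<lambda>n. measure (image_measure (xor_ca ^^ n) \<mu>) (cylinder u)) \<longlonglongrightarrow> measure dirac_zero (cylinder u)"
    by (simp only: image dirac)
qed

text \<open>The average \<open>h\<close> of the indicator of \<open>B\<close> along a stretch of
  length \<open>p\<close> is close to the constant \<open>c\<close> outside the rare set
  \<open>E\<close>. Invariance of \<open>A\<close> makes the integral of \<open>h\<close> over
  \<open>A\<close> equal to the measure of \<open>A \<inter> B\<close>.\<close>

lemma measure_invariant_Int_close:
  assumes A: "A \<in> sets config_space" "shift -` A = A"
    and B: "depends_on {0..<int w} B" and w: "w \<le> per (Suc m)"
  shows "\<bar>measure \<mu> (A \<inter> B) - measure \<mu> A * freq m B\<bar> \<le> (1 / 2) ^ m + tail (Suc m) + real w / real (per m)"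
proof -
  define p where "p = per (Suc m)"
  define E where "E = atypical w m B"
  define c where "c = freq m B"
  define h where "h x = orbit_freq p x B" for x
  have p: "p > 0" by (simp add: p_def)
  have BW: "B \<in> windows" by (rule depends_on_imp_windows[OF B]) simp
  have EW: "E \<in> windows"
    unfolding E_def by (rule depends_on_imp_windows[OF depends_on_atypical[OF B]]) simp
  have E_sets: "E \<in> sets \<mu>" using windows_sets[OF EW] by simp
  have A_sets: "A \<in> sets \<mu>" using A by simp
  note A_inv = translate_invariant[OF A(2)]
  have AB_sets: "A \<inter> translate (int z) -` B \<in> sets \<mu>" for z
    using A_sets windows_sets[OF windows_translate[OF BW]] by auto
  \<comment> \<open>Since \<open>A\<close> is its own preimage, translating \<open>B\<close> is the
    same as translating \<open>A \<inter> B\<close>.\<close>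
  have AB: "measure \<mu> (A \<inter> translate (int z) -` B) = measure \<mu> (A \<inter> B)" for z
  proof -
    have "A \<inter> translate (int z) -` B = translate (int z) -` (A \<inter> B)"
      using A_inv[of z] by blast
    then show ?thesis
      using measure_translate[of "A \<inter> B" z] A(1) windows_sets[OF BW] by (simp add: sets.Int)
  qed
  have int: "integrable \<mu> (indicator S :: config \<Rightarrow> real)" if "S \<in> sets \<mu>" for S
    using that by (intro integrable_real_indicator) (simp_all add: emeasure_eq_measure)
  have Ah: "indicator A x * h x = (\<Sum>z<p. indicator (A \<inter> translate (int z) -` B) x) / real p" for x
    by (simp add: h_def orbit_freq_def sum_distrib_left indicator_def)
  have int_Ah: "integrable \<mu> (\<lambda>x. indicator A x * h x)"
    unfolding Ah
    by (intro Bochner_Integration.integrable_divide Bochner_Integration.integrable_sum int AB_sets)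
  have "(\<integral>x. indicator A x * h x \<partial>\<mu>) = (\<Sum>z<p. \<integral>x. indicator (A \<inter> translate (int z) -` B) x \<partial>\<mu>) / real p"
    unfolding Ah using int[OF AB_sets] by (simp add: integral_sum)
  also have "\<dots> = (\<Sum>z<p. measure \<mu> (A \<inter> B)) / real p"
    using AB_sets AB by (simp add: sets.Int_space_eq2)
  also have "\<dots> = measure \<mu> (A \<inter> B)" using p by simp
  finally have "(\<integral>x. indicator A x * h x \<partial>\<mu>) = measure \<mu> (A \<inter> B)" .
  moreover have "(\<integral>x. indicator A x * c \<partial>\<mu>) = measure \<mu> A * c"
    using A_sets by simp
  ultimately have "measure \<mu> (A \<inter> B) - measure \<mu> A * c = (\<integral>x. indicator A x * h x - indicator A x * c \<partial>\<mu>)"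
    using int_Ah int[OF A_sets] by (simp add: integral_diff)
  also have "\<bar>\<dots>\<bar> \<le> (\<integral>x. \<bar>indicator A x * h x - indicator A x * c\<bar> \<partial>\<mu>)"
    by (rule integral_abs_bound)
  also have "\<dots> \<le> (\<integral>x. indicator E x + real w / real (per m) \<partial>\<mu>)"
  proof (rule integral_mono)
    show "integrable \<mu> (\<lambda>x. \<bar>indicator A x * h x - indicator A x * c\<bar>)"
      using int_Ah int[OF A_sets] by (intro integrable_abs Bochner_Integration.integrable_diff) simp_all
    show "integrable \<mu> (\<lambda>x. indicator E x + real w / real (per m))"
      using int[OF E_sets] by (intro Bochner_Integration.integrable_add) simp_all
    fix x
    have "\<bar>h x - c\<bar> \<le> 1"
      using orbit_freq_nonneg[of p x B] orbit_freq_le_1[of p x B] freq_nonneg[of m B] freq_le_1[of m B]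
      unfolding h_def c_def by linarith
    \<comment> \<open>On \<open>E\<close> the trivial bound 1 is used, off \<open>E\<close> the
      definition of \<open>atypical\<close>.\<close>
    then have "\<bar>h x - c\<bar> \<le> indicator E x + real w / real (per m)"
    proof (cases "x \<in> E")
      case True
      then show ?thesis using \<open>\<bar>h x - c\<bar> \<le> 1\<close> by (simp add: add_increasing2)
    next
      case False
      then show ?thesis by (simp add: E_def atypical_def h_def c_def p_def)
    qed
    moreover have "\<bar>indicator A x * h x - indicator A x * c\<bar> \<le> \<bar>h x - c\<bar>"
      by (simp add: indicator_def)
    ultimately show "\<bar>indicator A x * h x - indicator A x * c\<bar> \<le> indicator E x + real w / real (per m)"
      by linarith
  qed
  also have "\<dots> = measure \<mu> E + real w / real (per m)"
    using int[OF E_sets] E_sets by (simp add: prob_space[unfolded space_eq])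
  also have "measure \<mu> E \<le> (1 / 2) ^ m + tail (Suc m)"
  proof -
    have "\<bar>lim_freq E - freq (Suc m) E\<bar> \<le> tail (Suc m)"
      unfolding E_def by (rule lim_freq_tail[OF depends_on_atypical[OF B]]) (use w in simp)
    moreover have "freq (Suc m) E \<le> (1 / 2) ^ m"
      unfolding E_def by (rule freq_atypical_le[OF B])
    ultimately show ?thesis using measure_windows[OF EW] by linarith
  qed
  finally show ?thesis by (simp add: c_def)
qed

lemma measure_invariant_Int_window:
  assumes A: "A \<in> sets config_space" "shift -` A = A" and B: "depends_on {0..<int w} B"
  shows "measure \<mu> (A \<inter> B) = measure \<mu> A * measure \<mu> B"
proof -
  have BW: "B \<in> windows" by (rule depends_on_imp_windows[OF B]) simp
  have "filterlim (\<lambda>m. real (per m)) at_top sequentially"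
    by (rule filterlim_at_top_mono[OF filterlim_real_sequentially])
       (auto intro!: always_eventually less_imp_le less_per)
  then have "(\<lambda>m. real w / real (per m)) \<longlonglongrightarrow> 0"
    by (intro tendsto_divide_0[OF tendsto_const] filterlim_at_top_imp_at_infinity)
  then have "(\<lambda>m. (1 / 2) ^ m + tail (Suc m) + real w / real (per m)) \<longlonglongrightarrow> 0 + 0 + 0"
    by (intro tendsto_add LIMSEQ_realpow_zero LIMSEQ_Suc[OF tail_tendsto_0]) auto
  then have bound: "(\<lambda>m. (1 / 2) ^ m + tail (Suc m) + real w / real (per m)) \<longlonglongrightarrow> 0" by simp
  have "w \<le> per (Suc m)" if "w \<le> m" for m using less_per[of "Suc m"] that by linarith
  then have "\<forall>\<^sub>F m in sequentially. norm (measure \<mu> (A \<inter> B) - measure \<mu> A * freq m B)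
      \<le> (1 / 2) ^ m + tail (Suc m) + real w / real (per m)"
    unfolding eventually_sequentially real_norm_def
    by (intro exI[of _ w] allI impI measure_invariant_Int_close[OF A B]) blast
  then have "(\<lambda>m. measure \<mu> (A \<inter> B) - measure \<mu> A * freq m B) \<longlonglongrightarrow> 0"
    using bound by (rule Lim_null_comparison)
  moreover have "(\<lambda>m. measure \<mu> (A \<inter> B) - measure \<mu> A * freq m B)
      \<longlonglongrightarrow> measure \<mu> (A \<inter> B) - measure \<mu> A * lim_freq B"
    by (intro tendsto_intros freq_LIMSEQ BW)
  ultimately show ?thesis using LIMSEQ_unique measure_windows[OF BW] by fastforce
qed

text \<open>Independence from windows extends to the generated sigma-algebra by Dynkin induction
  over disjoint unions and complements.\<close>

lemma measure_invariant_Int: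
  assumes A: "A \<in> sets config_space" "shift -` A = A" and B: "B \<in> sets config_space"
  shows "measure \<mu> (A \<inter> B) = measure \<mu> A * measure \<mu> B"
proof -
  have A_sets: "A \<in> sets \<mu>" using A by simp
  have sub: "C \<in> sets \<mu>" if "C \<in> sigma_sets UNIV windows" for C
    using that by (simp add: sets_config_space_eq)
  have "windows \<subseteq> Pow UNIV" "B \<in> sigma_sets UNIV windows"
    using B by (simp_all only: sets_config_space_eq Pow_UNIV subset_UNIV)
  from Int_stable_windows this show ?thesis
  proof (induction rule: sigma_sets_induct_disjoint)
    case (basic C)
    obtain w where w: "depends_on {0..<int (2 * w)} (translate (int w) -` C)"
      using windows_translate_nonneg[OF basic] .
    have C: "C \<in> sets config_space" by (rule windows_sets[OF basic])
    \<comment> \<open>The window is first moved to nonnegative cells, which leaves \<open>A\<close>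
      fixed.\<close>
    have "translate (int w) -` A = A" by (rule translate_invariant[OF A(2)])
    then have "A \<inter> translate (int w) -` C = translate (int w) -` (A \<inter> C)" by blast
    then have "measure \<mu> (A \<inter> C) = measure \<mu> (A \<inter> translate (int w) -` C)"
      using measure_translate[of "A \<inter> C" w] A(1) C by (simp add: sets.Int)
    also have "\<dots> = measure \<mu> A * measure \<mu> (translate (int w) -` C)"
      by (rule measure_invariant_Int_window[OF A w])
    finally show ?case by (simp only: measure_translate[OF C])
  next
    case (compl C)
    have C: "C \<in> sets \<mu>" by (rule sub[OF compl(1)])
    have "A \<inter> (UNIV - C) = A - A \<inter> C" by auto
    then have "measure \<mu> (A \<inter> (UNIV - C)) = measure \<mu> A - measure \<mu> (A \<inter> C)"
      using A_sets C by (simp add: finite_measure_Diff)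
    moreover have "measure \<mu> (UNIV - C) = 1 - measure \<mu> C"
      using prob_compl[OF C] by simp
    ultimately show ?case by (simp only: compl(2) right_diff_distrib mult_1_right)
  next
    case (union F)
    have F: "range F \<subseteq> sets \<mu>" using union(2) sub by blast
    have "(\<lambda>i. measure \<mu> (F i)) sums measure \<mu> (\<Union>i. F i)"
      by (rule finite_measure_UNION[OF F union(1)])
    then have "(\<lambda>i. measure \<mu> A * measure \<mu> (F i)) sums (measure \<mu> A * measure \<mu> (\<Union>i. F i))"
      by (rule sums_mult)
    moreover have "(\<lambda>i. measure \<mu> (A \<inter> F i)) sums measure \<mu> (\<Union>i. A \<inter> F i)"
    proof (rule finite_measure_UNION)
      show "range (\<lambda>i. A \<inter> F i) \<subseteq> sets \<mu>" using F A_sets by blast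
      show "disjoint_family (\<lambda>i. A \<inter> F i)" using union(1) unfolding disjoint_family_on_def by blast
    qed
    moreover have "(\<Union>i. A \<inter> F i) = A \<inter> (\<Union>i. F i)" by blast
    ultimately show ?case using union(3) sums_unique2 by (metis (no_types, lifting) sums_cong)
  qed simp_all
qed

text \<open>An invariant set is independent of itself, so its measure equals its square.\<close>

lemma ergodic: "ergodic \<mu>"
  unfolding ergodic_def
proof (intro ballI impI)
  fix A assume A: "A \<in> sets config_space" "shift -` A = A"
  have "measure \<mu> A = measure \<mu> A * measure \<mu> A"
    using measure_invariant_Int[OF A A(1)] by simp
  then show "measure \<mu> A = 0 \<or> measure \<mu> A = 1" by simp
qed

end

theorem theorem2:
  shows "\<exists>\<mu> :: config measure.
    config_prob \<mu> \<and> shift_invariant \<mu> \<and> ergodic \<mu> \<and> full_support \<mu> \<and>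
    weak_star_converges (\<lambda>n. image_measure (xor_ca ^^ n) \<mu>) dirac_zero"
proof -
  obtain \<mu> where "config_prob \<mu>" "\<forall>A\<in>windows. measure \<mu> A = lim_freq A"
    using exists_limit_measure by blast
  then interpret limit_measure \<mu> by unfold_locales auto
  show ?thesis
    using config_prob shift_invariant ergodic full_support weak_star by blast
qed

end
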